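(* Let $(I,+,\preceq_I,\ast)$ be a partially ordered commutative ring. Let $x_1,\dots,x_7\in I$ with $x_i\succeq_I x_{i+1}$ for $1\leq i\leq 6$ and $x_1+x_6\succeq_I x_2+x_5\succeq_I x_3+x_4$, and let $n\geq 0$ be an integer. Suppose that the multiplicative inverse $(x_2-x_6)^{-1}$ exists in $I$ and $(x_2-x_6)^{-1}\succ_I 0$. Let $a_1,\dots,a_7\in I$ and suppose that for each $i\in\{2,4,6\}$ there is an upper bound $\hat a_i\in I$ of $\{a_i,-a_i\}$ such that $a_1\succeq_I\hat a_2\succeq_I a_5\succeq_I\hat a_6\succeq_I 0$, $a_3\succeq_I\hat a_4\succeq_I 0$, and either $a_5+a_7\succeq_I\hat a_6\succeq_I a_7\succeq_I 0$ or $a_7\succeq_I\hat a_6\succeq_I 0$. Then $$\sum_{i=1}^7 a_i\ast\prod_{\substack{1\leq j\leq 7\\ j\neq i}}(x_i-x_j)^n\succeq_I 0,$$ where the product is taken with respect to $\ast$.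
   Context: A partially ordered Abelian group $(I,+,\preceq_I)$ is an Abelian group with a partial order such that $x+z\preceq_I y+z\Leftrightarrow x\preceq_I y$ for all $x,y,z\in I$. A partially ordered commutative ring $(I,+,\preceq_I,\ast)$ is a partially ordered Abelian group together with an operation $\ast:I\times I\to I$ that is associative, commutative, distributive over $+$, nonnegativity-preserving ($x\succeq_I 0$ and $y\succeq_I 0$ imply $x\ast y\succeq_I 0$), and has an identity element in $I$. Powers $x^n$ and inverses are with respect to $\ast$. An element $u$ is an upper bound of $S\subset I$ if $u\succeq_I s$ for all $s\in S$. *)

theory Defs
  imports Main
begin

end

theory Submission
  imports Defs
begin

text \<open>
  Let \<open>P\<^sub>i\<close> be the product of the \<open>\<bar>x\<^sub>i - x\<^sub>j\<bar>\<^sup>n\<close>. For odd \<open>i\<close> the product in the statement is \<open>P\<^sub>i\<close>, for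
  even \<open>i\<close> it is \<open>P\<^sub>i\<close> or \<open>- P\<^sub>i\<close>, so by Abel summation over the chain of coefficients it
  suffices that \<open>P\<^sub>2 \<le> P\<^sub>1\<close>, \<open>P\<^sub>4 \<le> P\<^sub>3\<close> and \<open>0 \<le> P\<^sub>1 - P\<^sub>2 + P\<^sub>5 - P\<^sub>6\<close>. For the last one, drop the
  factors with \<open>x\<^sub>7\<close> and say that the interval \<open>[l, u]\<close> dominates \<open>[l', u']\<close> if it starts further
  right and is at least as long. On nonnegative intervals this relation is preserved by
  endpointwise products, and \<open>[P\<^sub>2, P\<^sub>1]\<close> and \<open>[P\<^sub>5, P\<^sub>6]\<close> factor into four pairs of intervals for
  which it follows from the hypotheses. The invertibility of \<open>x\<^sub>2 - x\<^sub>6\<close> enters only through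
  \<open>0 \<le> 1\<close>, which is not an axiom of partially ordered rings.
\<close>

lemma power_nonneg:
  fixes a :: "'a :: {comm_ring_1, ordered_ring}"
  assumes "(0::'a) \<le> 1" "0 \<le> a"
  shows "0 \<le> a ^ n"
  by (induction n) (use assms in auto)

lemma power_mono_nonneg:
  fixes a b :: "'a :: {comm_ring_1, ordered_ring}"
  assumes "(0::'a) \<le> 1" "0 \<le> a" "a \<le> b"
  shows "a ^ n \<le> b ^ n"
proof (induction n)
  case (Suc n)
  then show ?case
    using assms order_trans[OF assms(2,3)] by (simp add: mult_mono power_nonneg)
qed simp

definition dominates :: "'a :: {comm_ring_1, ordered_ring} \<Rightarrow> 'a \<Rightarrow> 'a \<Rightarrow> 'a \<Rightarrow> bool"
  where "dominates l u l' u' \<longleftrightarrow> 0 \<le> l' \<and> l' \<le> u' \<and> l' \<le> l \<and> u' - l' \<le> u - l"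

lemma dominatesD:
  assumes "dominates l u l' u'"
  shows "0 \<le> l'" "l' \<le> u'" "l' \<le> l" "u' - l' \<le> u - l" "l \<le> u" "u' \<le> u" "0 \<le> l" "0 \<le> u'" "0 \<le> u"
proof -
  show *: "0 \<le> l'" "l' \<le> u'" "l' \<le> l" "u' - l' \<le> u - l"
    using assms by (auto simp: dominates_def)
  have "0 \<le> u' - l'" using * by simp
  from order_trans[OF this *(4)] show lu: "l \<le> u" by simp
  show uu: "u' \<le> u" using add_mono[OF *(4,3)] by simp
  show l: "0 \<le> l" "0 \<le> u'" using * by (meson order_trans)+
  show "0 \<le> u" using l lu by (meson order_trans)
qed

text \<open>Split the length as \<open>u * v - l * k = u * (v - k) + (u - l) * k\<close>. All
  factors are nonnegative, so each summand is monotone.\<close>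

lemma dominates_mult:
  assumes "dominates l u l' u'" "dominates k v k' v'"
  shows "dominates (l * k) (u * v) (l' * k') (u' * v')"
proof -
  note a = dominatesD[OF assms(1)] and b = dominatesD[OF assms(2)]
  have "u' * (v' - k') \<le> u * (v - k)"
    by (rule mult_mono) (use a b in auto)
  moreover have "(u' - l') * k' \<le> (u - l) * k"
    by (rule mult_mono) (use a b in auto)
  ultimately have "u' * (v' - k') + (u' - l') * k' \<le> u * (v - k) + (u - l) * k"
    by (rule add_mono)
  then have "u' * v' - l' * k' \<le> u * v - l * k"
    by (simp add: algebra_simps)
  moreover have "l' * k' \<le> u' * v'" "l' * k' \<le> l * k"
    by (rule mult_mono; use a b in auto)+
  ultimately show ?thesis
    using a b by (simp add: dominates_def)
qed

lemma dominates_power: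
  fixes l :: "'a :: {comm_ring_1, ordered_ring}"
  assumes "(0::'a) \<le> 1" "dominates l u l' u'"
  shows "dominates (l ^ n) (u ^ n) (l' ^ n) (u' ^ n)"
proof (induction n)
  case 0
  then show ?case using assms(1) by (simp add: dominates_def)
next
  case (Suc n)
  then show ?case using assms(2) by (simp add: dominates_mult)
qed

text \<open>The parity of \<open>n\<close> decides the sign of \<open>(- z) ^ n\<close>; bounding
  both \<open>a\<close> and \<open>- a\<close> by \<open>b\<close> covers either sign.\<close>

lemma uminus_mult_le_mult_power_uminus:
  fixes a b z :: "'a :: {comm_ring_1, ordered_ring}"
  assumes "(0::'a) \<le> 1" "0 \<le> z" "a \<le> b" "- a \<le> b"
  shows "- (b * z ^ n) \<le> a * (- z) ^ n"
proof -
  have z: "0 \<le> z ^ n" using assms power_nonneg by blast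
  have "- a * z ^ n \<le> b * z ^ n" "a * z ^ n \<le> b * z ^ n"
    using mult_right_mono z assms by blast+
  then have "- (b * z ^ n) \<le> a * z ^ n" "- (b * z ^ n) \<le> - (a * z ^ n)"
    by (simp_all add: minus_le_iff)
  then show ?thesis
    by (cases "even n") simp_all
qed

theorem theorem14:
  fixes x a a_hat :: "nat \<Rightarrow> 'a :: {comm_ring_1, ordered_ring}"
    and y :: 'a and n :: nat
  assumes "\<And>i. i \<in> {1..6} \<Longrightarrow> x i \<ge> x (i + 1)"
    and "x 1 + x 6 \<ge> x 2 + x 5" and "x 2 + x 5 \<ge> x 3 + x 4"
    and "(x 2 - x 6) * y = 1" and "y > 0"
    and "\<And>i. i \<in> {2, 4, 6} \<Longrightarrow> a_hat i \<ge> a i \<and> a_hat i \<ge> - a i"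
    and "a 1 \<ge> a_hat 2" and "a_hat 2 \<ge> a 5" and "a 5 \<ge> a_hat 6" and "a_hat 6 \<ge> 0"
    and "a 3 \<ge> a_hat 4" and "a_hat 4 \<ge> 0"
    and "(a 5 + a 7 \<ge> a_hat 6 \<and> a_hat 6 \<ge> a 7 \<and> a 7 \<ge> 0) \<or> (a 7 \<ge> a_hat 6 \<and> a_hat 6 \<ge> 0)"
  shows "(\<Sum>i = 1..7. a i * (\<Prod>j \<in> {1..7} - {i}. (x i - x j) ^ n)) \<ge> 0"
proof -
  note [simp del] = One_nat_def
  define d where "d i j = x i - x j" for i j
  have dn: "0 \<le> d i j" if "1 \<le> i" "i \<le> j" "j \<le> 7" for i j
    using that(2,1,3)
  proof (induction rule: dec_induct)
    case base
    then show ?case by (simp add: d_def)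
  next
    case (step k)
    then have "x (Suc k) \<le> x k" "x k \<le> x i"
      using assms(1)[of k] by (auto simp: d_def Suc_eq_plus1)
    then show ?case by (simp add: d_def)
  qed
  have one: "(0::'a) \<le> 1"
    using mult_nonneg_nonneg[of "d 2 6" y] dn[of 2 6] assms(4,5) by (simp add: d_def)

  \<comment> \<open>The hypotheses on sums, rewritten as comparisons of gaps.\<close>
  have d1256: "d 5 6 \<le> d 1 2" and d2345: "d 4 5 \<le> d 2 3"
    using assms(2,3) by (simp_all add: d_def algebra_simps)

  define A where "A = d 1 3 * d 1 4 * d 1 5 * (d 1 2 * d 1 6)"
  define B where "B = d 2 3 * d 2 4 * d 2 5 * (d 1 2 * d 2 6)"
  define C where "C = d 4 5 * d 3 5 * d 2 5 * (d 5 6 * d 1 5)"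
  define D where "D = d 4 6 * d 3 6 * d 2 6 * (d 5 6 * d 1 6)"

  \<comment> \<open>In the first three pairs the lengths are \<open>d 1 2\<close> and
    \<open>d 5 6\<close>; the left ends are compared by \<open>d2345\<close> or coincide.\<close>
  have "dominates (d 2 3) (d 1 3) (d 4 5) (d 4 6)"
    using dn[of 4 5] dn[of 5 6] d1256 d2345 by (simp add: dominates_def d_def algebra_simps)
  moreover have "dominates (d 2 4) (d 1 4) (d 3 5) (d 3 6)"
    using dn[of 3 5] dn[of 5 6] d1256 d2345 by (simp add: dominates_def d_def algebra_simps)
  moreover have "dominates (d 2 5) (d 1 5) (d 2 5) (d 2 6)"
    using dn[of 2 5] dn[of 5 6] d1256 by (simp add: dominates_def d_def algebra_simps)
  \<comment> \<open>Two factors stay together here: \<open>d 1 5 <= d 2 6\<close> alone would need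
    the reverse of \<open>d1256\<close>. The lengths are the squares of \<open>d 1 2\<close> and
    \<open>d 5 6\<close>.\<close>
  moreover have "dominates (d 1 2 * d 2 6) (d 1 2 * d 1 6) (d 5 6 * d 1 5) (d 5 6 * d 1 6)"
    unfolding dominates_def
  proof (intro conjI)
    show "0 \<le> d 5 6 * d 1 5" by (simp add: dn)
    show "d 5 6 * d 1 5 \<le> d 5 6 * d 1 6"
      by (rule mult_left_mono) (use dn[of 5 6] in \<open>auto simp: d_def\<close>)
    have "0 \<le> (d 1 2 - d 5 6) * d 2 5"
      using d1256 dn by simp
    also have "\<dots> = d 1 2 * d 2 6 - d 5 6 * d 1 5"
      by (simp add: d_def algebra_simps)
    finally show "d 5 6 * d 1 5 \<le> d 1 2 * d 2 6" by simp
    have "d 5 6 * d 5 6 \<le> d 1 2 * d 1 2"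
      using d1256 dn by (simp add: mult_mono)
    then show "d 5 6 * d 1 6 - d 5 6 * d 1 5 \<le> d 1 2 * d 1 6 - d 1 2 * d 2 6"
      by (simp add: d_def algebra_simps)
  qed
  ultimately have "dominates B A C D"
    unfolding A_def B_def C_def D_def by (blast intro: dominates_mult)
  then have dom: "dominates (B ^ n) (A ^ n) (C ^ n) (D ^ n)"
    using one by (rule dominates_power[rotated])

  define P where "P i = (\<Prod>j \<in> {1..7} - {i}. d (min i j) (max i j)) ^ n" for i
  have Q_nonneg: "0 \<le> (\<Prod>j \<in> J. d (min i j) (max i j))" if "i \<in> {1..7}" "J \<subseteq> {1..7}" for i J
    using finite_subset[OF that(2) finite_atLeastAtMost] that(2)
  proof (induction J rule: finite_induct)
    case (insert j J)
    then show ?case using that(1) by (auto intro!: mult_nonneg_nonneg dn)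
  qed (simp add: one)
  then have Pn: "0 \<le> P i" if "i \<in> {1..7}" for i
    unfolding P_def using that by (intro power_nonneg one) auto
  have sets: "{1..7} - {1} = {2,3,4,5,6,7::nat}" "{1..7} - {2} = {1,3,4,5,6,7::nat}"
    "{1..7} - {3} = {1,2,4,5,6,7::nat}" "{1..7} - {4} = {1,2,3,5,6,7::nat}"
    "{1..7} - {5} = {1,2,3,4,6,7::nat}" "{1..7} - {6} = {1,2,3,4,5,7::nat}"
    "{1..7} - {7} = {1,2,3,4,5,6::nat}"
    by auto
  have P1: "P 1 = d 1 7 ^ n * A ^ n" and P2: "P 2 = d 2 7 ^ n * B ^ n"
    and P5: "P 5 = d 5 7 ^ n * C ^ n" and P6: "P 6 = d 6 7 ^ n * D ^ n"
    by (simp_all add: P_def sets A_def B_def C_def D_def power_mult_distrib[symmetric] mult_ac)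

  have "P 2 \<le> d 2 7 ^ n * A ^ n"
    unfolding P2 by (rule mult_left_mono) (use dominatesD[OF dom] power_nonneg[OF one dn, of 2 7] in auto)
  moreover have "d 2 7 ^ n * A ^ n \<le> P 1"
    unfolding P1 by (rule mult_right_mono[OF power_mono_nonneg])
      (use dominatesD[OF dom] dn[of 2 7] dn[of 1 2] one in \<open>auto simp: d_def\<close>)
  ultimately have P21: "P 2 \<le> P 1"
    by (rule order_trans)

  \<comment> \<open>Replacing \<open>d 6 7\<close> by \<open>d 5 7\<close> in \<open>P 6\<close> and
    \<open>d 1 7\<close> by \<open>d 2 7\<close> in \<open>P 1\<close> gives each difference a
    common factor, so that \<open>dom\<close> applies.\<close>
  have "P 6 - P 5 \<le> d 5 7 ^ n * D ^ n - P 5"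
    unfolding P6 by (intro diff_right_mono mult_right_mono power_mono_nonneg)
      (use dominatesD[OF dom] dn[of 6 7] dn[of 5 6] one in \<open>auto simp: d_def\<close>)
  also have "\<dots> = d 5 7 ^ n * (D ^ n - C ^ n)"
    by (simp add: P5 algebra_simps)
  also have "\<dots> \<le> d 2 7 ^ n * (A ^ n - B ^ n)"
    by (intro mult_mono power_mono_nonneg power_nonneg)
      (use dominatesD[OF dom] dn[of 5 7] dn[of 2 5] dn[of 2 7] one in \<open>auto simp: d_def\<close>)
  also have "\<dots> = d 2 7 ^ n * A ^ n - P 2"
    by (simp add: P2 algebra_simps)
  also have "\<dots> \<le> P 1 - P 2"
    using \<open>d 2 7 ^ n * A ^ n \<le> P 1\<close> by simp
  finally have P1256: "0 \<le> P 1 - P 2 + P 5 - P 6"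
    by (simp add: algebra_simps)

  have P43: "P 4 \<le> P 3"
  proof -
    \<comment> \<open>Since \<open>d 1 3 <= d 1 4\<close>, single factors cannot be compared.
      Distances to \<open>x 1\<close> and \<open>x 6\<close> are paired, then those to
      \<open>x 2\<close> and \<open>x 5\<close>: \<open>x 3\<close> divides each interval more
      evenly than \<open>x 4\<close>.\<close>
    have "0 \<le> (d 1 3 - d 4 6) * d 3 4"
      using d1256 d2345 dn[of 3 4] add_mono[OF d1256 d2345]
      by (intro mult_nonneg_nonneg) (auto simp: d_def algebra_simps)
    also have "\<dots> = d 1 3 * d 3 6 - d 1 4 * d 4 6"
      by (simp add: d_def algebra_simps)
    finally have *: "d 1 4 * d 4 6 \<le> d 1 3 * d 3 6" by simp
    have "0 \<le> (d 2 3 - d 4 5) * d 3 4"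
      using d2345 dn by simp
    also have "\<dots> = d 2 3 * d 3 5 - d 2 4 * d 4 5"
      by (simp add: d_def algebra_simps)
    finally have **: "d 2 4 * d 4 5 \<le> d 2 3 * d 3 5" by simp
    have ***: "d 4 7 \<le> d 3 7"
      using dn[of 3 4] by (simp add: d_def)
    have "(d 1 4 * d 4 6) * (d 2 4 * d 4 5) * d 4 7 * d 3 4
        \<le> (d 1 3 * d 3 6) * (d 2 3 * d 3 5) * d 3 7 * d 3 4"
      by (intro mult_mono * ** *** order_refl mult_nonneg_nonneg dn) auto
    then have "((d 1 4 * d 4 6) * (d 2 4 * d 4 5) * d 4 7 * d 3 4) ^ n
        \<le> ((d 1 3 * d 3 6) * (d 2 3 * d 3 5) * d 3 7 * d 3 4) ^ n"
      by (intro power_mono_nonneg one mult_nonneg_nonneg dn) auto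
    then show ?thesis
      by (simp add: P_def sets mult_ac)
  qed

  define p where "p i = (\<Prod>j \<in> {1..7} - {i}. (x i - x j) ^ n)" for i
  have p_eq: "p i = (\<Prod>j \<in> {1..7} - {i}. if j < i then - d j i else d i j) ^ n" for i
    unfolding p_def prod_power_distrib by (rule prod.cong) (auto simp: d_def)
  \<comment> \<open>Exactly \<open>i - 1\<close> factors are negative: the signs cancel for odd
    \<open>i\<close>, and one minus remains under the power for even \<open>i\<close>.\<close>
  have p_odd: "p i = P i" if "i \<in> {1,3,5,7}" for i
    using that by (auto simp: p_eq P_def sets)
  have p_even: "- (a_hat i * P i) \<le> a i * p i" if "i \<in> {2,4,6}" for i
  proof -
    define Q where "Q = (\<Prod>j \<in> {1..7} - {i}. d (min i j) (max i j))"
    have "p i = (- Q) ^ n"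
      using that by (auto simp: p_eq Q_def sets)
    moreover have "0 \<le> Q"
      unfolding Q_def using that by (intro Q_nonneg) auto
    ultimately show ?thesis
      using uminus_mult_le_mult_power_uminus[OF one, of Q "a i" "a_hat i" n] assms(6)[OF that]
      by (simp add: P_def Q_def)
  qed

  \<comment> \<open>The left side is a lower bound of the sum. The right side is Abel summation
    along \<open>a 1\<close>, \<open>a_hat 2\<close>, \<open>a 5\<close>, \<open>a_hat 6\<close>
    and, separately, along \<open>a 3\<close>, \<open>a_hat 4\<close>.\<close>
  have "a 1 * P 1 - a_hat 2 * P 2 + (a 3 * P 3 - a_hat 4 * P 4) + (a 5 * P 5 - a_hat 6 * P 6) + a 7 * P 7
      = (a 1 - a_hat 2) * P 1 + (a_hat 2 - a 5) * (P 1 - P 2) + (a 5 - a_hat 6) * (P 1 - P 2 + P 5)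
        + a_hat 6 * (P 1 - P 2 + P 5 - P 6) + (a 3 - a_hat 4) * P 3 + a_hat 4 * (P 3 - P 4) + a 7 * P 7"
    by (simp add: algebra_simps)
  \<comment> \<open>Substituting back through the equation turns this into nonnegativity of the
    lower bound.\<close>
  also have "0 \<le> \<dots>"
  proof (intro add_nonneg_nonneg mult_nonneg_nonneg)
    show "0 \<le> a 7" using assms(13) by (meson order_trans)
  qed (use assms(7-12) P21 P43 P1256 Pn in auto)
  also have "a 1 * P 1 - a_hat 2 * P 2 + (a 3 * P 3 - a_hat 4 * P 4) + (a 5 * P 5 - a_hat 6 * P 6) + a 7 * P 7
      \<le> a 1 * p 1 + a 2 * p 2 + (a 3 * p 3 + a 4 * p 4) + (a 5 * p 5 + a 6 * p 6) + a 7 * p 7"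
    unfolding diff_conv_add_uminus by (intro add_mono p_even) (auto simp: p_odd)
  also have "\<dots> = (\<Sum>i = 1..7. a i * p i)"
  proof -
    have "{1..7} = {1,2,3,4,5,6,7::nat}" by auto
    then show ?thesis by (simp add: add_ac)
  qed
  finally show ?thesis by (simp add: p_def)
qed

end
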